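(* Let $f:\mathbb{T}\to\mathbb{R}$ be a time series, $N\ge1$, and let $\Psi_f$ be its $N$-truncated Liouville torus. Let $\ell$ be the diagonal ray, i.e. the ray with direction vector $\mathbf a=(1,\dots,1)$ and endpoint $\mathbf b=(0,\dots,0)$ in $\mathbb{R}^N$. Then for every integer $n\ge0$, $\mathsf{bcd}_n^{\mathcal R,\ell}(\Psi_f)=\mathsf{bcd}_n^{\mathcal R}(\Psi_f)$.
   Context: For a metric space $(X,d)$ and $\epsilon\in\mathbb{R}$, the Vietoris–Rips complex $\mathcal R_\epsilon(X)$ is the simplicial complex whose simplices are the nonempty finite subsets $\{x_0,\dots,x_n\}\subset X$ with $\max_{i,j}d(x_i,x_j)<\epsilon$ (empty for $\epsilon\le 0$). The $n$-dimensional barcode of a one-parameter filtration is the multiset of intervals (bars) $(b,d]$ (or $(b,\infty)$) of its $n$-dimensional persistent homology over a fixed field; for q-tame modules it is the persistence diagram, each off-diagonal point $(b,d)$ recorded as the bar $(b,d]$. $\mathsf{bcd}_n^{\mathcal R}(X)$ is the barcode of $\{\mathcal R_\epsilon(X)\}_{\epsilon\in\mathbb{R}}$. The product $K\times K'$ of simplicial complexes has vertex set the product of vertex sets, a finite set being a simplex iff both coordinate projections are simplices. $\mathbb{T}=\mathbb{R}/2\pi\mathbb{Z}$; $\hat f(L)=\frac1{2\pi}\int_0^{2\pi}f(t)e^{-iLt}\,dt$; $r_L^f=2|\hat f(L)|$. The $N$-truncated Liouville torus $\Psi_f$ is the Liouville torus in phase space $\mathbb{R}^{2N}$ of $H(\mathbf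 q,\mathbf p)=\sum_{L=1}^N\frac L2(p_L^2+q_L^2)$ on which $\frac{p_L^2+q_L^2}{2}=\frac{(r_L^f)^2}{2}$ for each $L$; i.e. $\Psi_f=\{(\mathbf q,\mathbf p): q_L^2+p_L^2=(r_L^f)^2,\ L=1,\dots,N\}$, with the maximum metric (maximum over $L$ of the Euclidean distances of the components in the $(q_L,p_L)$-planes). $\pi_L$ is the projection onto the $(q_L,p_L)$-plane. For a ray $\ell(t)=\mathbf b+\sqrt N\,t\,\frac{\mathbf a}{\|\mathbf a\|}$ with all $a_i>0$ ($\|\cdot\|$ Euclidean), $\mathsf{bcd}_n^{\mathcal R,\ell}(\Psi_f)$ is the $n$-dimensional barcode of the filtration $$\mathcal R^\ell_t(\Psi_f)=\mathcal R_{b_1+\sqrt N t a_1/\|\mathbf a\|}(\pi_1\Psi_f)\times\cdots\times\mathcal R_{b_N+\sqrt N t a_N/\|\mathbf a\|}(\pi_N\Psi_f),\qquad t\in\mathbb{R}.$$ *)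

theory Defs
  imports
    "HOL-Analysis.Analysis"
    "Jordan_Normal_Form.VS_Connect"
begin

section \<open>Simplicial complexes\<close>

definition simplicial_complex :: "'v set set \<Rightarrow> bool" where
  "simplicial_complex K \<longleftrightarrow>
     (\<forall>\<sigma>\<in>K. finite \<sigma> \<and> \<sigma> \<noteq> {}) \<and> (\<forall>\<sigma>\<in>K. \<forall>\<tau>. \<tau> \<subseteq> \<sigma> \<longrightarrow> \<tau> \<noteq> {} \<longrightarrow> \<tau> \<in> K)"

definition vietoris_rips :: "'v set \<Rightarrow> ('v \<Rightarrow> 'v \<Rightarrow> real) \<Rightarrow> real \<Rightarrow> 'v set set" where
  "vietoris_rips X d \<epsilon> =
     {\<sigma>. finite \<sigma> \<and> \<sigma> \<noteq> {} \<and> \<sigma> \<subseteq> X \<and> Max ((\<lambda>(x, y). d x y) ` (\<sigma> \<times> \<sigma>)) < \<epsilon>}"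

definition product_complex :: "'i set \<Rightarrow> ('i \<Rightarrow> 'v set set) \<Rightarrow> ('i \<Rightarrow> 'v) set set" where
  "product_complex I K =
     {\<sigma>. finite \<sigma> \<and> \<sigma> \<noteq> {} \<and> \<sigma> \<subseteq> PiE I (\<lambda>i. \<Union>(K i)) \<and> (\<forall>i\<in>I. (\<lambda>x. x i) ` \<sigma> \<in> K i)}"

lemma simplicial_complex_vietoris_rips: "simplicial_complex (vietoris_rips X d \<epsilon>)"
  unfolding simplicial_complex_def
proof (intro conjI ballI allI impI)
  fix \<sigma> \<tau> assume *: "\<sigma> \<in> vietoris_rips X d \<epsilon>" "\<tau> \<subseteq> \<sigma>" "\<tau> \<noteq> {}"
  then have fin: "finite \<sigma>" "finite \<tau>"
    by (auto simp: vietoris_rips_def intro: finite_subset)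
  have "Max ((\<lambda>(x, y). d x y) ` (\<tau> \<times> \<tau>)) \<le> Max ((\<lambda>(x, y). d x y) ` (\<sigma> \<times> \<sigma>))"
    using * fin by (intro Max_mono image_mono) auto
  then show "\<tau> \<in> vietoris_rips X d \<epsilon>"
    using * fin by (simp add: vietoris_rips_def) (meson order.trans le_less_trans)
qed (auto simp: vietoris_rips_def)

lemma vietoris_rips_mono: "s \<le> t \<Longrightarrow> vietoris_rips X d s \<subseteq> vietoris_rips X d t"
  by (auto simp: vietoris_rips_def)

lemma simplicial_complex_product_complex:
  assumes "\<And>i. i \<in> I \<Longrightarrow> simplicial_complex (K i)"
  shows "simplicial_complex (product_complex I K)"
  unfolding simplicial_complex_def
proof (intro conjI ballI allI impI)
  fix \<sigma> \<tau> assume *: "\<sigma> \<in> product_complex I K" "\<tau> \<subseteq> \<sigma>" "\<tau> \<noteq> {}"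
  have "(\<lambda>x. x i) ` \<tau> \<in> K i" if "i \<in> I" for i
  proof -
    have "(\<lambda>x. x i) ` \<sigma> \<in> K i" "(\<lambda>x. x i) ` \<tau> \<subseteq> (\<lambda>x. x i) ` \<sigma>"
      using * that by (auto simp: product_complex_def)
    then show ?thesis
      using assms[OF that] *(3) unfolding simplicial_complex_def by (metis image_is_empty)
  qed
  then show "\<tau> \<in> product_complex I K"
    using * by (auto simp: product_complex_def intro: finite_subset)
qed (auto simp: product_complex_def)

section \<open>Simplicial homology over a field\<close>

text \<open>
  An oriented \<open>n\<close>-chain with coefficients in the field \<open>'k\<close> is a finitely supported alternating
  function \<open>c\<close> on ordered \<open>n\<close>-simplices \<open>[v\<^sub>0, \<dots>, v\<^sub>n]\<close>, the value \<open>c [v\<^sub>0, \<dots>, v\<^sub>n]\<close> being the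
  coefficient of the oriented simplex \<open>[v\<^sub>0, \<dots>, v\<^sub>n]\<close>.
\<close>

definition oriented_chains :: "nat \<Rightarrow> 'v set set \<Rightarrow> ('v list \<Rightarrow> 'k::field) set" where
  "oriented_chains n K =
     {c. finite {xs. c xs \<noteq> 0} \<and>
         (\<forall>xs. c xs \<noteq> 0 \<longrightarrow> length xs = Suc n \<and> distinct xs \<and> set xs \<in> K) \<and>
         (\<forall>xs i j. i < j \<longrightarrow> j < length xs \<longrightarrow> c (xs[i := xs ! j, j := xs ! i]) = - c xs)}"

text \<open>
  Since \<open>[v\<^sub>i, v\<^sub>0, \<dots>, v\<^sub>i\<^sub>-\<^sub>1, v\<^sub>i\<^sub>+\<^sub>1, \<dots>, v\<^sub>n] = (-1)\<^sup>i [v\<^sub>0, \<dots>, v\<^sub>n]\<close> as oriented simplices, the usual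
  formula \<open>\<partial>[v\<^sub>0, \<dots>, v\<^sub>n] = (\<Sum>i\<le>n. (-1)\<^sup>i [v\<^sub>0, \<dots>, v\<^sub>i\<^sub>-\<^sub>1, v\<^sub>i\<^sub>+\<^sub>1, \<dots>, v\<^sub>n])\<close> says that the coefficient
  of \<open>[y\<^sub>1, \<dots>, y\<^sub>n]\<close> in \<open>\<partial>c\<close> is the sum of all \<open>c [v, y\<^sub>1, \<dots>, y\<^sub>n]\<close>. Homology is unreduced, so
  the boundary of a \<open>0\<close>-chain is \<open>0\<close>.
\<close>

definition boundary :: "nat \<Rightarrow> ('v list \<Rightarrow> 'k::field) \<Rightarrow> 'v list \<Rightarrow> 'k" where
  "boundary n c = (\<lambda>ys. if n = 0 then 0 else (\<Sum>v | c (v # ys) \<noteq> 0. c (v # ys)))"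

definition cycles :: "nat \<Rightarrow> 'v set set \<Rightarrow> ('v list \<Rightarrow> 'k::field) set" where
  "cycles n K = {c \<in> oriented_chains n K. boundary n c = (\<lambda>_. 0)}"

definition boundaries :: "nat \<Rightarrow> 'v set set \<Rightarrow> ('v list \<Rightarrow> 'k::field) set" where
  "boundaries n K = boundary (Suc n) ` oriented_chains (Suc n) K"

lemma oriented_chains_lincomb:
  assumes "c \<in> oriented_chains n K" "d \<in> oriented_chains n K"
  shows "(\<lambda>xs. a * c xs + d xs) \<in> oriented_chains n K"
proof -
  have "finite {xs. a * c xs + d xs \<noteq> 0}"
    by (rule finite_subset[of _ "{xs. c xs \<noteq> 0} \<union> {xs. d xs \<noteq> 0}"])
       (use assms in \<open>auto simp: oriented_chains_def\<close>)
  moreover have "c xs \<noteq> 0 \<or> d xs \<noteq> 0" if "a * c xs + d xs \<noteq> 0" for xs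
    using that by auto
  ultimately show ?thesis
    using assms unfolding oriented_chains_def by fastforce
qed

lemma oriented_chains_finite:
  assumes "c \<in> oriented_chains n K"
  shows "finite {v. c (v # ys) \<noteq> 0}"
proof (rule finite_imageD)
  show "finite ((\<lambda>v. v # ys) ` {v. c (v # ys) \<noteq> 0})"
    by (rule finite_subset[of _ "{xs. c xs \<noteq> 0}"])
       (use assms in \<open>auto simp: oriented_chains_def\<close>)
qed (simp add: inj_on_def)

lemma oriented_chains_swap:
  "c \<in> oriented_chains n K \<Longrightarrow> i < j \<Longrightarrow> j < length xs \<Longrightarrow>
    c (xs[i := xs ! j, j := xs ! i]) = - c xs"
  by (simp add: oriented_chains_def)

lemma boundary_lincomb:
  fixes c d :: "'v list \<Rightarrow> 'k::field"
  assumes "c \<in> oriented_chains n K" "d \<in> oriented_chains n K"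
  shows "boundary n (\<lambda>xs. a * c xs + d xs) = (\<lambda>ys. a * boundary n c ys + boundary n d ys)"
proof (cases "n = 0")
  case False
  show ?thesis
  proof
    fix ys
    let ?S = "{v. c (v # ys) \<noteq> 0} \<union> {v. d (v # ys) \<noteq> 0}"
    have fin: "finite ?S"
      using assms oriented_chains_finite by blast
    have *: "(\<Sum>v | e (v # ys) \<noteq> 0. e (v # ys)) = (\<Sum>v\<in>?S. e (v # ys))"
      if "{v. e (v # ys) \<noteq> 0} \<subseteq> ?S" for e :: "_ \<Rightarrow> 'k"
      using that fin by (intro sum.mono_neutral_left) auto
    have "(\<Sum>v | a * c (v # ys) + d (v # ys) \<noteq> 0. a * c (v # ys) + d (v # ys))
        = (\<Sum>v\<in>?S. a * c (v # ys) + d (v # ys))"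
      by (rule *) auto
    also have "\<dots> = a * (\<Sum>v\<in>?S. c (v # ys)) + (\<Sum>v\<in>?S. d (v # ys))"
      by (simp only: sum.distrib sum_distrib_left)
    also have "(\<Sum>v\<in>?S. c (v # ys)) = (\<Sum>v | c (v # ys) \<noteq> 0. c (v # ys))"
      by (rule *[symmetric]) auto
    also have "(\<Sum>v\<in>?S. d (v # ys)) = (\<Sum>v | d (v # ys) \<noteq> 0. d (v # ys))"
      by (rule *[symmetric]) auto
    finally show
      "boundary n (\<lambda>xs. a * c xs + d xs) ys = a * boundary n c ys + boundary n d ys"
      using False by (simp add: boundary_def)
  qed
qed (simp add: boundary_def)

lemma boundary_in_oriented_chains:
  assumes K: "simplicial_complex K" and c: "c \<in> oriented_chains (Suc n) K"
  shows "boundary (Suc n) c \<in> oriented_chains n K"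
proof -
  have ex: "\<exists>v. c (v # ys) \<noteq> 0" if "boundary (Suc n) c ys \<noteq> 0" for ys
    using that by (auto simp: boundary_def elim: sum.not_neutral_contains_not_neutral)
  have "finite {ys. boundary (Suc n) c ys \<noteq> 0}"
    by (rule finite_subset[of _ "tl ` {xs. c xs \<noteq> 0}"])
       (use ex c in \<open>force simp: oriented_chains_def\<close>)+
  moreover have "length ys = Suc n \<and> distinct ys \<and> set ys \<in> K"
    if nz: "boundary (Suc n) c ys \<noteq> 0" for ys
  proof -
    obtain v where v: "c (v # ys) \<noteq> 0"
      using ex[OF nz] by blast
    have *: "length (v # ys) = Suc (Suc n) \<and> distinct (v # ys) \<and> set (v # ys) \<in> K"
      using c v unfolding oriented_chains_def by blast
    then have "set ys \<noteq> {}" "set ys \<subseteq> set (v # ys)"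
      by auto
    with * show ?thesis
      using K unfolding simplicial_complex_def by auto
  qed
  moreover have "boundary (Suc n) c (ys[i := ys ! j, j := ys ! i]) = - boundary (Suc n) c ys"
    if "i < j" "j < length ys" for ys i j
  proof -
    have "c (v # ys[i := ys ! j, j := ys ! i]) = - c (v # ys)" for v
    proof -
      have "c ((v # ys)[Suc i := (v # ys) ! Suc j, Suc j := (v # ys) ! Suc i]) = - c (v # ys)"
        using that by (intro oriented_chains_swap[OF c]) auto
      then show ?thesis
        by simp
    qed
    then show ?thesis
      by (simp add: boundary_def sum_negf)
  qed
  ultimately show ?thesis
    unfolding oriented_chains_def by blast
qed

lemma sum_alternating_eq_0:
  fixes g :: "'a \<Rightarrow> 'a \<Rightarrow> 'k::field"
  assumes "finite S" "\<And>v. g v v = 0" "\<And>v w. g v w = - g w v"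
  shows "(\<Sum>v\<in>S. \<Sum>w\<in>S. g v w) = 0"
  using assms(1)
proof (induction S)
  case (insert x S)
  have "(\<Sum>v\<in>S. g v x) = - (\<Sum>v\<in>S. g x v)"
    unfolding sum_negf[symmetric] by (rule sum.cong[OF refl assms(3)])
  then show ?case
    using insert.hyps insert.IH assms(2) by (simp add: sum.distrib)
qed simp

lemma boundary_boundary:
  assumes "c \<in> oriented_chains (Suc n) K"
  shows "boundary n (boundary (Suc n) c) = (\<lambda>_. 0)"
proof (cases "n = 0")
  case False
  show ?thesis
  proof
    fix ys
    define S where "S = \<Union>(set ` {xs. c xs \<noteq> 0})"
    have fin: "finite S"
      using assms by (auto simp: S_def oriented_chains_def)
    have S: "v \<in> S \<and> w \<in> S" if "c (w # v # ys) \<noteq> 0" for v w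
      using that by (force simp: S_def)
    have inner: "boundary (Suc n) c (v # ys) = (\<Sum>w\<in>S. c (w # v # ys))" for v
    proof -
      have "(\<Sum>w | c (w # v # ys) \<noteq> 0. c (w # v # ys)) = (\<Sum>w\<in>S. c (w # v # ys))"
        using S by (intro sum.mono_neutral_left fin) auto
      then show ?thesis
        by (simp add: boundary_def)
    qed
    have "{v. boundary (Suc n) c (v # ys) \<noteq> 0} \<subseteq> S"
      unfolding inner using S by (auto elim: sum.not_neutral_contains_not_neutral)
    then have "(\<Sum>v | boundary (Suc n) c (v # ys) \<noteq> 0. boundary (Suc n) c (v # ys))
        = (\<Sum>v\<in>S. boundary (Suc n) c (v # ys))"
      by (intro sum.mono_neutral_left fin) auto
    then have "boundary n (boundary (Suc n) c) ys = (\<Sum>v\<in>S. \<Sum>w\<in>S. c (w # v # ys))"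
      using False by (simp only: boundary_def[of n] inner if_False)
    also have "\<dots> = 0"
    proof (rule sum_alternating_eq_0[OF fin])
      show "c (v # v # ys) = 0" for v
      proof (rule ccontr)
        assume "c (v # v # ys) \<noteq> 0"
        then have "distinct (v # v # ys)"
          using assms unfolding oriented_chains_def by blast
        then show False
          by simp
      qed
      show "c (w # v # ys) = - c (v # w # ys)" for v w
      proof -
        let ?xs = "v # w # ys"
        have "c (?xs[0 := ?xs ! 1, 1 := ?xs ! 0]) = - c ?xs"
          using oriented_chains_swap[OF assms, of 0 1 ?xs] by simp
        then show ?thesis
          by simp
      qed
    qed
    finally show "boundary n (boundary (Suc n) c) ys = 0" .
  qed
qed (simp add: boundary_def)

definition fun_coset :: "('a \<Rightarrow> 'k::field) set \<Rightarrow> ('a \<Rightarrow> 'k) \<Rightarrow> ('a \<Rightarrow> 'k) set" where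
  "fun_coset B z = {\<lambda>x. z x + b x | b. b \<in> B}"

text \<open>
  The quotient vector space \<open>Z / B\<close> of subspaces \<open>B \<subseteq> Z\<close> of a function space. The fields
  \<open>mult\<close> and \<open>one\<close> of the record type of modules play no role for a module.
\<close>

definition quotient_space ::
    "('a \<Rightarrow> 'k::field) set \<Rightarrow> ('a \<Rightarrow> 'k) set \<Rightarrow> ('k, ('a \<Rightarrow> 'k) set) module" where
  "quotient_space Z B =
     \<lparr> carrier = fun_coset B ` Z, mult = undefined, one = undefined, zero = fun_coset B (\<lambda>_. 0),
       add = (\<lambda>X Y. \<Union>f\<in>X. \<Union>g\<in>Y. fun_coset B (\<lambda>x. f x + g x)),
       smult = (\<lambda>a X. \<Union>f\<in>X. fun_coset B (\<lambda>x. a * f x)) \<rparr>"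

definition homology ::
    "nat \<Rightarrow> 'v set set \<Rightarrow> ('k::field, ('v list \<Rightarrow> 'k) set) module" where
  "homology n K = quotient_space (cycles n K) (boundaries n K)"

definition fun_subspace :: "('a \<Rightarrow> 'k::field) set \<Rightarrow> bool" where
  "fun_subspace Z \<longleftrightarrow> (\<lambda>_. 0) \<in> Z \<and> (\<forall>f\<in>Z. \<forall>g\<in>Z. \<forall>a. (\<lambda>x. a * f x + g x) \<in> Z)"

lemma fun_subspaceD:
  assumes "fun_subspace Z"
  shows "(\<lambda>_. 0) \<in> Z" "f \<in> Z \<Longrightarrow> g \<in> Z \<Longrightarrow> (\<lambda>x. f x + g x) \<in> Z"
    "f \<in> Z \<Longrightarrow> (\<lambda>x. a * f x) \<in> Z" "f \<in> Z \<Longrightarrow> g \<in> Z \<Longrightarrow> (\<lambda>x. f x - g x) \<in> Z"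
proof -
  have lc: "(\<lambda>x. a * f x + g x) \<in> Z" if "f \<in> Z" "g \<in> Z" for a f g
    using assms that by (simp add: fun_subspace_def)
  show 0: "(\<lambda>_. 0) \<in> Z"
    using assms by (simp add: fun_subspace_def)
  show "f \<in> Z \<Longrightarrow> g \<in> Z \<Longrightarrow> (\<lambda>x. f x + g x) \<in> Z"
    using lc[of f g 1] by simp
  show "f \<in> Z \<Longrightarrow> (\<lambda>x. a * f x) \<in> Z"
    using lc[OF _ 0, of f a] by simp
  show "f \<in> Z \<Longrightarrow> g \<in> Z \<Longrightarrow> (\<lambda>x. f x - g x) \<in> Z"
    using lc[of g f "-1"] by (simp add: algebra_simps)
qed

lemma mem_fun_coset: "g \<in> fun_coset B f \<longleftrightarrow> (\<lambda>x. g x - f x) \<in> B"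
proof
  assume "g \<in> fun_coset B f"
  then show "(\<lambda>x. g x - f x) \<in> B"
    by (auto simp: fun_coset_def)
next
  assume "(\<lambda>x. g x - f x) \<in> B"
  then show "g \<in> fun_coset B f"
    unfolding fun_coset_def by (intro CollectI exI[of _ "\<lambda>x. g x - f x"]) auto
qed

lemma fun_coset_eqI:
  assumes B: "fun_subspace B" and fg: "(\<lambda>x. f x - g x) \<in> B"
  shows "fun_coset B f = fun_coset B g"
proof -
  have "(\<lambda>x. h x - f x) \<in> B \<longleftrightarrow> (\<lambda>x. h x - g x) \<in> B" for h
    using fun_subspaceD(2)[OF B _ fg, of "\<lambda>x. h x - f x"]
      fun_subspaceD(4)[OF B _ fg, of "\<lambda>x. h x - g x"] by auto
  then show ?thesis
    by (auto simp: mem_fun_coset)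
qed

lemma fun_coset_self: "fun_subspace B \<Longrightarrow> f \<in> fun_coset B f"
  by (simp add: mem_fun_coset fun_subspaceD(1))

lemma quotient_space_add:
  assumes "fun_subspace B"
  shows "fun_coset B f \<oplus>\<^bsub>quotient_space Z B\<^esub> fun_coset B g = fun_coset B (\<lambda>x. f x + g x)"
proof -
  have "fun_coset B (\<lambda>x. f' x + g' x) = fun_coset B (\<lambda>x. f x + g x)"
    if "f' \<in> fun_coset B f" "g' \<in> fun_coset B g" for f' g'
    using that fun_subspaceD(2)[OF assms, of "\<lambda>x. f' x - f x" "\<lambda>x. g' x - g x"]
    by (intro fun_coset_eqI assms) (simp add: mem_fun_coset algebra_simps)
  then have "(\<Union>f'\<in>fun_coset B f. \<Union>g'\<in>fun_coset B g. fun_coset B (\<lambda>x. f' x + g' x))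
      = fun_coset B (\<lambda>x. f x + g x)"
    using fun_coset_self[OF assms, of f] fun_coset_self[OF assms, of g] by blast
  then show ?thesis
    by (simp add: quotient_space_def)
qed

lemma quotient_space_smult:
  assumes "fun_subspace B"
  shows "a \<odot>\<^bsub>quotient_space Z B\<^esub> fun_coset B f = fun_coset B (\<lambda>x. a * f x)"
proof -
  have "fun_coset B (\<lambda>x. a * f' x) = fun_coset B (\<lambda>x. a * f x)" if "f' \<in> fun_coset B f" for f'
    using that fun_subspaceD(3)[OF assms, of "\<lambda>x. f' x - f x" a]
    by (intro fun_coset_eqI assms) (simp add: mem_fun_coset algebra_simps)
  then have "(\<Union>f'\<in>fun_coset B f. fun_coset B (\<lambda>x. a * f' x)) = fun_coset B (\<lambda>x. a * f x)"
    using fun_coset_self[OF assms, of f] by blast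
  then show ?thesis
    by (simp add: quotient_space_def)
qed

lemma vectorspace_quotient_space:
  assumes Z: "fun_subspace Z" and B: "fun_subspace B"
  shows "vectorspace class_ring (quotient_space Z B)" (is "vectorspace _ ?Q")
proof -
  have carrier: "carrier ?Q = fun_coset B ` Z"
    and zero: "\<zero>\<^bsub>?Q\<^esub> = fun_coset B (\<lambda>_. 0)"
    by (simp_all add: quotient_space_def)
  note ops = quotient_space_add[OF B] quotient_space_smult[OF B]
  have carrierI: "f \<in> Z \<Longrightarrow> fun_coset B f \<in> carrier ?Q" for f
    by (simp add: carrier)
  have carrierE: thesis if "X \<in> carrier ?Q" "\<And>f. f \<in> Z \<Longrightarrow> X = fun_coset B f \<Longrightarrow> thesis"
    for X thesis
    using that by (auto simp: carrier)
  show ?thesis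
  proof (rule vs_criteria[OF class_field]; (intro allI ballI impI)?; (elim conjE)?)
    show "\<zero>\<^bsub>?Q\<^esub> \<in> carrier ?Q"
      unfolding zero by (intro carrierI fun_subspaceD(1)[OF Z])
    show "X \<oplus>\<^bsub>?Q\<^esub> Y \<in> carrier ?Q" if "X \<in> carrier ?Q" "Y \<in> carrier ?Q" for X Y
      using that by (elim carrierE) (simp add: ops carrierI fun_subspaceD(2)[OF Z])
    show "a \<odot>\<^bsub>?Q\<^esub> X \<in> carrier ?Q" if "X \<in> carrier ?Q" for a X
      using that by (elim carrierE) (simp add: ops carrierI fun_subspaceD(3)[OF Z])
    show "\<exists>Y\<in>carrier ?Q. X \<oplus>\<^bsub>?Q\<^esub> Y = \<zero>\<^bsub>?Q\<^esub>" if X: "X \<in> carrier ?Q" for X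
    proof -
      obtain f where f: "f \<in> Z" "X = fun_coset B f"
        using X by (rule carrierE)
      show ?thesis
        using fun_subspaceD(3)[OF Z f(1), of "-1"]
        by (intro bexI[of _ "fun_coset B (\<lambda>x. - f x)"] carrierI) (simp_all add: f(2) ops zero)
    qed
    show "X \<oplus>\<^bsub>?Q\<^esub> Y = Y \<oplus>\<^bsub>?Q\<^esub> X" if "X \<in> carrier ?Q" "Y \<in> carrier ?Q" for X Y
      using that by (elim carrierE) (simp add: ops add.commute)
    show "X \<oplus>\<^bsub>?Q\<^esub> Y \<oplus>\<^bsub>?Q\<^esub> W = X \<oplus>\<^bsub>?Q\<^esub> (Y \<oplus>\<^bsub>?Q\<^esub> W)"
      if "X \<in> carrier ?Q" "Y \<in> carrier ?Q" "W \<in> carrier ?Q" for X Y W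
      using that by (elim carrierE) (simp add: ops add.assoc)
    show "X \<oplus>\<^bsub>?Q\<^esub> \<zero>\<^bsub>?Q\<^esub> = X" if "X \<in> carrier ?Q" for X
      using that by (elim carrierE) (simp add: ops zero)
    show "(a \<otimes>\<^bsub>class_ring\<^esub> b) \<odot>\<^bsub>?Q\<^esub> X = a \<odot>\<^bsub>?Q\<^esub> (b \<odot>\<^bsub>?Q\<^esub> X)"
      if "X \<in> carrier ?Q" for a b X
      using that by (elim carrierE) (simp add: ops mult.assoc)
    show "\<one>\<^bsub>class_ring\<^esub> \<odot>\<^bsub>?Q\<^esub> X = X" if "X \<in> carrier ?Q" for X
      using that by (elim carrierE) (simp add: ops)
    show "(a \<oplus>\<^bsub>class_ring\<^esub> b) \<odot>\<^bsub>?Q\<^esub> X = a \<odot>\<^bsub>?Q\<^esub> X \<oplus>\<^bsub>?Q\<^esub> b \<odot>\<^bsub>?Q\<^esub> X"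
      if "X \<in> carrier ?Q" for a b X
      using that by (elim carrierE) (simp add: ops distrib_right)
    show "a \<odot>\<^bsub>?Q\<^esub> (X \<oplus>\<^bsub>?Q\<^esub> Y) = a \<odot>\<^bsub>?Q\<^esub> X \<oplus>\<^bsub>?Q\<^esub> a \<odot>\<^bsub>?Q\<^esub> Y"
      if "X \<in> carrier ?Q" "Y \<in> carrier ?Q" for a X Y
      using that by (elim carrierE) (simp add: ops distrib_left)
  qed
qed

lemma zero_oriented_chain:
  "(\<lambda>_. 0) \<in> oriented_chains n K" "boundary n (\<lambda>_. 0) = (\<lambda>_. 0)"
  by (auto simp: oriented_chains_def boundary_def)

lemma fun_subspace_cycles: "fun_subspace (cycles n K :: ('v list \<Rightarrow> 'k::field) set)"
  unfolding fun_subspace_def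
proof (intro conjI ballI allI)
  show "(\<lambda>_. 0) \<in> cycles n K"
    by (simp add: cycles_def zero_oriented_chain)
  fix f g :: "'v list \<Rightarrow> 'k" and a assume "f \<in> cycles n K" "g \<in> cycles n K"
  then have fg: "f \<in> oriented_chains n K" "g \<in> oriented_chains n K"
    "boundary n f = (\<lambda>_. 0)" "boundary n g = (\<lambda>_. 0)"
    by (simp_all add: cycles_def)
  show "(\<lambda>x. a * f x + g x) \<in> cycles n K"
    using oriented_chains_lincomb[OF fg(1,2), of a] boundary_lincomb[OF fg(1,2), of a]
    unfolding cycles_def fg(3,4) by simp
qed

lemma fun_subspace_boundaries: "fun_subspace (boundaries n K :: ('v list \<Rightarrow> 'k::field) set)"
  unfolding fun_subspace_def
proof (intro conjI ballI allI)
  show "(\<lambda>_. 0) \<in> boundaries n K"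
    unfolding boundaries_def
    by (rule image_eqI[of _ _ "\<lambda>_. 0"]) (simp_all add: zero_oriented_chain)
  fix f g :: "'v list \<Rightarrow> 'k" and a assume "f \<in> boundaries n K" "g \<in> boundaries n K"
  then obtain c d :: "'v list \<Rightarrow> 'k"
    where cd: "c \<in> oriented_chains (Suc n) K" "d \<in> oriented_chains (Suc n) K"
      "f = boundary (Suc n) c" "g = boundary (Suc n) d"
    by (auto simp: boundaries_def)
  have "boundary (Suc n) (\<lambda>xs. a * c xs + d xs) = (\<lambda>x. a * f x + g x)"
    unfolding cd(3,4) by (rule boundary_lincomb[OF cd(1,2)])
  then show "(\<lambda>x. a * f x + g x) \<in> boundaries n K"
    unfolding boundaries_def
    by (intro image_eqI[of _ _ "\<lambda>xs. a * c xs + d xs"] oriented_chains_lincomb[OF cd(1,2)])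
      (rule sym)
qed

lemma boundaries_subset_cycles:
  assumes "simplicial_complex K"
  shows "boundaries n K \<subseteq> cycles n K"
proof
  fix z :: "'a list \<Rightarrow> 'b" assume "z \<in> boundaries n K"
  then obtain c :: "'a list \<Rightarrow> 'b" where c: "c \<in> oriented_chains (Suc n) K" "z = boundary (Suc n) c"
    by (auto simp: boundaries_def)
  show "z \<in> cycles n K"
    using boundary_in_oriented_chains[OF assms c(1)] boundary_boundary[OF c(1)]
    by (simp add: cycles_def c(2))
qed

lemma vectorspace_homology: "vectorspace class_ring (homology n K)"
  unfolding homology_def
  by (intro vectorspace_quotient_space fun_subspace_cycles fun_subspace_boundaries)

text \<open>The map induced on homology by the inclusion of a subcomplex into \<open>L\<close>.\<close>

definition homology_incl ::
    "nat \<Rightarrow> 'v set set \<Rightarrow> ('v list \<Rightarrow> 'k::field) set \<Rightarrow> ('v list \<Rightarrow> 'k) set" where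
  "homology_incl n L X = (\<Union>z\<in>X. fun_coset (boundaries n L) z)"

lemma homology_incl_coset:
  assumes "K \<subseteq> L"
  shows "homology_incl n L (fun_coset (boundaries n K) z) = fun_coset (boundaries n L) z"
proof -
  have "oriented_chains (Suc n) K \<subseteq> oriented_chains (Suc n) L"
    using assms by (auto simp: oriented_chains_def)
  then have "boundaries n K \<subseteq> boundaries n L"
    by (auto simp: boundaries_def)
  then have eq: "fun_coset (boundaries n L) w = fun_coset (boundaries n L) z"
    if "w \<in> fun_coset (boundaries n K) z" for w
    using that by (intro fun_coset_eqI fun_subspace_boundaries) (auto simp: mem_fun_coset)
  have "z \<in> fun_coset (boundaries n K) z"
    by (intro fun_coset_self fun_subspace_boundaries)
  then show ?thesis
    unfolding homology_incl_def using eq by blast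
qed

lemma linear_map_homology_incl:
  assumes "K \<subseteq> L"
  shows "linear_map class_ring (homology n K) (homology n L) (homology_incl n L)"
proof -
  interpret K: vectorspace class_ring "homology n K"
    by (rule vectorspace_homology)
  interpret L: vectorspace class_ring "homology n L"
    by (rule vectorspace_homology)
  have sub: "cycles n K \<subseteq> cycles n L"
    using assms by (auto simp: cycles_def oriented_chains_def)
  note rules = homology_incl_coset[OF assms] quotient_space_add quotient_space_smult
    fun_subspace_boundaries
  have carrierE: thesis if "X \<in> carrier (homology n K)"
    "\<And>z. z \<in> cycles n L \<Longrightarrow> X = fun_coset (boundaries n K) z \<Longrightarrow> thesis" for X thesis
    using that sub by (auto simp: homology_def quotient_space_def)
  have "homology_incl n L \<in> module_hom class_ring (homology n K) (homology n L)"
    unfolding module_hom_def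
  proof (intro CollectI conjI allI impI funcsetI; (elim conjE)?)
    show "homology_incl n L X \<in> carrier (homology n L)" if "X \<in> carrier (homology n K)" for X
      using that by (elim carrierE) (simp add: rules, simp add: homology_def quotient_space_def)
    show "homology_incl n L (X \<oplus>\<^bsub>homology n K\<^esub> Y)
        = homology_incl n L X \<oplus>\<^bsub>homology n L\<^esub> homology_incl n L Y"
      if "X \<in> carrier (homology n K)" "Y \<in> carrier (homology n K)" for X Y
      using that by (elim carrierE) (simp add: rules homology_def)
    show "homology_incl n L (a \<odot>\<^bsub>homology n K\<^esub> X) = a \<odot>\<^bsub>homology n L\<^esub> homology_incl n L X"
      if "X \<in> carrier (homology n K)" for a X
      using that by (elim carrierE) (simp add: rules homology_def)
  qed
  then show ?thesis
    by unfold_locales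
qed

section \<open>Persistence diagrams and barcodes\<close>

text \<open>
  A one-parameter filtration is a family \<open>F\<close> of complexes with \<open>F s \<subseteq> F t\<close> for \<open>s \<le> t\<close>.
  The rank of \<open>H\<^sub>n(F s) \<rightarrow> H\<^sub>n(F t)\<close>; homology at the parameters \<open>-\<infinity>\<close> and \<open>\<infinity>\<close> is \<open>0\<close> by convention.
\<close>

definition persistent_rank ::
    "'k::field itself \<Rightarrow> nat \<Rightarrow> (real \<Rightarrow> 'v set set) \<Rightarrow> ereal \<Rightarrow> ereal \<Rightarrow> nat" where
  "persistent_rank k n F s t =
     (if \<bar>s\<bar> = \<infinity> \<or> \<bar>t\<bar> = \<infinity> then 0
      else let K = F (real_of_ereal s); L = F (real_of_ereal t);
               HK = homology n K :: ('k, ('v list \<Rightarrow> 'k) set) module;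
               HL = homology n L :: ('k, ('v list \<Rightarrow> 'k) set) module
           in vectorspace.dim class_ring (HL\<lparr>carrier := homology_incl n L ` carrier HK\<rparr>))"

text \<open>
  The persistence diagram of a q-tame persistence module (all ranks for \<open>s < t\<close> are finite), as
  a multiplicity function on the points of the open extended half-plane above the diagonal: the
  rectangle measure counts the points of the diagram in \<open>[a, b] \<times> [c, d]\<close>, and the multiplicity
  of \<open>(p, q)\<close> is the minimum over all rectangles containing \<open>(p, q)\<close> in their interior relative
  to the extended plane.
\<close>

definition rectangle_measure ::
    "'k::field itself \<Rightarrow> nat \<Rightarrow> (real \<Rightarrow> 'v set set) \<Rightarrow> ereal \<Rightarrow> ereal \<Rightarrow> ereal \<Rightarrow> ereal \<Rightarrow> int" where
  "rectangle_measure k n F a b c d =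
     int (persistent_rank k n F b c) - int (persistent_rank k n F a c)
     - int (persistent_rank k n F b d) + int (persistent_rank k n F a d)"

definition diagram_mult ::
    "'k::field itself \<Rightarrow> nat \<Rightarrow> (real \<Rightarrow> 'v set set) \<Rightarrow> ereal \<Rightarrow> ereal \<Rightarrow> nat" where
  "diagram_mult k n F p q =
     (LEAST m. \<exists>a b c d. (a < p \<or> a = -\<infinity> \<and> p = -\<infinity>) \<and> p < b \<and> b < c \<and> c < q \<and>
                 (q < d \<or> q = \<infinity> \<and> d = \<infinity>) \<and> int m = rectangle_measure k n F a b c d)"

text \<open>The bar \<open>(b, d]\<close>, which is \<open>(b, \<infinity>)\<close> for \<open>d = \<infinity>\<close>.\<close>

definition bar :: "ereal \<Rightarrow> ereal \<Rightarrow> real set" where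
  "bar b d = {x. b < ereal x \<and> ereal x \<le> d}"

text \<open>A barcode is a possibly infinite multiset of intervals, given by its multiplicities.\<close>

definition barcode ::
    "'k::field itself \<Rightarrow> nat \<Rightarrow> (real \<Rightarrow> 'v set set) \<Rightarrow> real set \<Rightarrow> nat" where
  "barcode k n F I =
     (let b = Inf (ereal ` I); d = Sup (ereal ` I)
      in if b < d \<and> I = bar b d then diagram_mult k n F b d else 0)"

lemma barcode_bar:
  assumes "b < d"
  shows "barcode k n F (bar b d) = diagram_mult k n F b d"
proof -
  have "Inf (ereal ` bar b d) = b"
  proof (rule antisym)
    show "b \<le> Inf (ereal ` bar b d)"
      by (rule Inf_greatest) (auto simp: bar_def)
    show "Inf (ereal ` bar b d) \<le> b"
    proof (rule dense_ge)
      fix y assume "b < y"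
      then obtain x where "b < ereal x" "ereal x < min y d"
        using assms ereal_dense2[of b "min y d"] by auto
      then show "Inf (ereal ` bar b d) \<le> y"
        by (intro Inf_lower2[of "ereal x"]) (auto simp: bar_def)
    qed
  qed
  moreover have "Sup (ereal ` bar b d) = d"
  proof (rule antisym)
    show "Sup (ereal ` bar b d) \<le> d"
      by (rule Sup_least) (auto simp: bar_def)
    show "d \<le> Sup (ereal ` bar b d)"
    proof (rule dense_le)
      fix y assume "y < d"
      then obtain x where "max y b < ereal x" "ereal x < d"
        using assms ereal_dense2[of "max y b" d] by auto
      then show "y \<le> Sup (ereal ` bar b d)"
        by (intro Sup_upper2[of "ereal x"]) (auto simp: bar_def)
    qed
  qed
  ultimately show ?thesis
    using assms by (simp add: barcode_def)
qed

definition bcd_rips ::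
    "'k::field itself \<Rightarrow> nat \<Rightarrow> 'v set \<Rightarrow> ('v \<Rightarrow> 'v \<Rightarrow> real) \<Rightarrow> real set \<Rightarrow> nat" where
  "bcd_rips k n X d = barcode k n (vietoris_rips X d)"

section \<open>Liouville tori of time series\<close>

text \<open>Functions on \<open>\<real>/2\<pi>\<int>\<close> are \<open>2\<pi>\<close>-periodic functions on \<open>\<real>\<close>.\<close>

definition fourier_coeff :: "(real \<Rightarrow> real) \<Rightarrow> int \<Rightarrow> complex" where
  "fourier_coeff f L =
     1 / (2 * pi) * (LINT t:{0..2 * pi}|lebesgue. f t * exp (- (\<i> * of_int L * t)))"

definition torus_radius :: "(real \<Rightarrow> real) \<Rightarrow> nat \<Rightarrow> real" where
  "torus_radius f L = 2 * cmod (fourier_coeff f (int L))"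

text \<open>
  Phase space \<open>\<real>\<^sup>2\<^sup>N\<close> is identified with the product of the \<open>N\<close> planes with coordinates
  \<open>(q\<^sub>L, p\<^sub>L)\<close>: a point is an extensional function \<open>x\<close> on \<open>{1..N}\<close> with \<open>x L = (q\<^sub>L, p\<^sub>L)\<close>, and the
  projection to the \<open>L\<close>-th plane is evaluation at \<open>L\<close>.
\<close>

definition liouville_torus :: "(real \<Rightarrow> real) \<Rightarrow> nat \<Rightarrow> (nat \<Rightarrow> real \<times> real) set" where
  "liouville_torus f N = PiE {1..N} (\<lambda>L. {(q, p). q\<^sup>2 + p\<^sup>2 = (torus_radius f L)\<^sup>2})"

definition max_dist :: "nat \<Rightarrow> (nat \<Rightarrow> real \<times> real) \<Rightarrow> (nat \<Rightarrow> real \<times> real) \<Rightarrow> real" where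
  "max_dist N x y = Max ((\<lambda>L. dist (x L) (y L)) ` {1..N})"

lemma Metric_space_max_dist:
  assumes "N \<ge> 1"
  shows "Metric_space (liouville_torus f N) (max_dist N)"
proof
  have ne: "finite ((\<lambda>L. dist (x L) (y L)) ` {1..N})" "(\<lambda>L. dist (x L) (y L)) ` {1..N} \<noteq> {}"
    for x y :: "nat \<Rightarrow> real \<times> real"
    using assms by auto
  have le: "dist (x L) (y L) \<le> max_dist N x y" if "L \<in> {1..N}" for x y L
    using that by (auto simp: max_dist_def)
  show "0 \<le> max_dist N x y" for x y
    using order_trans[OF zero_le_dist le[of 1 x y]] assms by simp
  show "max_dist N x y = max_dist N y x" for x y
    by (simp add: max_dist_def dist_commute)
  show "max_dist N x z \<le> max_dist N x y + max_dist N y z" for x y z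
  proof -
    have "dist (x L) (z L) \<le> max_dist N x y + max_dist N y z" if "L \<in> {1..N}" for L
      using dist_triangle[of "x L" "z L" "y L"] le[OF that, of x y] le[OF that, of y z] by linarith
    then show ?thesis
      unfolding max_dist_def[of N x z] using ne[of x z] by (subst Max_le_iff) auto
  qed
  show "max_dist N x y = 0 \<longleftrightarrow> x = y"
    if "x \<in> liouville_torus f N" "y \<in> liouville_torus f N" for x y
  proof
    assume 0: "max_dist N x y = 0"
    have "x L = y L" if "L \<in> {1..N}" for L
      using le[OF that, of x y] 0 by simp
    then show "x = y"
      by (rule PiE_ext[OF that[unfolded liouville_torus_def]])
  next
    assume "x = y"
    then show "max_dist N x y = 0"
      using assms by (simp add: max_dist_def)
  qed
qed

section \<open>Barcodes along a ray\<close>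

text \<open>
  The filtration of \<open>X \<subseteq> \<real>\<^sup>2\<^sup>N\<close> along the ray with endpoint \<open>b\<close> and direction \<open>a\<close>, vectors of
  \<open>\<real>\<^sup>N\<close> being given by their components with index in \<open>{1..N}\<close>.
\<close>

definition ray_filtration ::
    "nat \<Rightarrow> (nat \<Rightarrow> real) \<Rightarrow> (nat \<Rightarrow> real) \<Rightarrow> (nat \<Rightarrow> real \<times> real) set
      \<Rightarrow> real \<Rightarrow> (nat \<Rightarrow> real \<times> real) set set" where
  "ray_filtration N a b X t =
     product_complex {1..N} (\<lambda>L. vietoris_rips ((\<lambda>x. x L) ` X) dist
       (b L + sqrt (real N) * t * a L / L2_set a {1..N}))"

definition bcd_ray ::
    "'k::field itself \<Rightarrow> nat \<Rightarrow> nat \<Rightarrow> (nat \<Rightarrow> real) \<Rightarrow> (nat \<Rightarrow> real)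
      \<Rightarrow> (nat \<Rightarrow> real \<times> real) set \<Rightarrow> real set \<Rightarrow> nat" where
  "bcd_ray k n N a b X = barcode k n (ray_filtration N a b X)"

end

theory Submission
  imports Defs
begin

text \<open>
  Along the diagonal ray every factor has parameter \<open>t\<close>, because \<open>\<parallel>a\<parallel> = sqrt N\<close>. The
  maximum metric is below \<open>t\<close> iff all component distances are, so for a product of subsets of the
  planes the Vietoris--Rips complex of the maximum metric is the product of the Vietoris--Rips
  complexes of the factors. Hence the two filtrations already agree as complexes.
\<close>

text \<open>Trades the maximum for a bound on each pair, so that the quantifiers over pairs and over
  coordinates can be interchanged.\<close>

lemma mem_vietoris_rips_iff:
  "\<sigma> \<in> vietoris_rips X d \<epsilon> \<longleftrightarrow>
     finite \<sigma> \<and> \<sigma> \<noteq> {} \<and> \<sigma> \<subseteq> X \<and> (\<forall>x\<in>\<sigma>. \<forall>y\<in>\<sigma>. d x y < \<epsilon>)"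
proof (cases "finite \<sigma> \<and> \<sigma> \<noteq> {}")
  case True
  then have "Max ((\<lambda>(x, y). d x y) ` (\<sigma> \<times> \<sigma>)) < \<epsilon> \<longleftrightarrow> (\<forall>x\<in>\<sigma>. \<forall>y\<in>\<sigma>. d x y < \<epsilon>)"
    by (subst Max_less_iff) auto
  then show ?thesis
    by (simp add: vietoris_rips_def)
qed (auto simp: vietoris_rips_def)

lemma max_dist_less_iff:
  assumes "N \<ge> 1"
  shows "max_dist N x y < \<epsilon> \<longleftrightarrow> (\<forall>L\<in>{1..N}. dist (x L) (y L) < \<epsilon>)"
  using assms unfolding max_dist_def by (subst Max_less_iff) auto

text \<open>The product form of \<open>X\<close> matters: for general \<open>X\<close>, points whose
  coordinates all come from \<open>X\<close> may lie outside \<open>X\<close>.\<close>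

lemma product_complex_vietoris_rips:
  fixes Y :: "nat \<Rightarrow> (real \<times> real) set"
  assumes N: "N \<ge> 1" and X: "X = PiE {1..N} Y"
  shows "product_complex {1..N} (\<lambda>L. vietoris_rips ((\<lambda>x. x L) ` X) dist \<epsilon>)
       = vietoris_rips X (max_dist N) \<epsilon>" (is "?P = ?R")
proof (intro equalityI subsetI)
  fix \<sigma> assume \<sigma>: "\<sigma> \<in> ?P"
  then have proj: "(\<lambda>x. x L) ` \<sigma> \<in> vietoris_rips ((\<lambda>x. x L) ` X) dist \<epsilon>"
    if "L \<in> {1..N}" for L
    using that by (simp add: product_complex_def)
  have "\<sigma> \<subseteq> X"
  proof
    fix x assume x: "x \<in> \<sigma>"
    have "x L \<in> Y L" if "L \<in> {1..N}" for L
    proof -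
      have "x L \<in> (\<lambda>x. x L) ` X"
        using proj[OF that] x unfolding mem_vietoris_rips_iff by blast
      then show ?thesis
        using that by (auto simp: X)
    qed
    \<comment> \<open>Outside \<open>{1..N}\<close>, \<open>x\<close> is fixed by the vertex set of
      the product complex.\<close>
    moreover have "x \<in> extensional {1..N}"
      using \<sigma> x by (auto simp: product_complex_def PiE_def)
    ultimately show "x \<in> X"
      by (simp add: X PiE_iff)
  qed
  then show "\<sigma> \<in> ?R"
    using \<sigma> proj
    by (simp add: mem_vietoris_rips_iff max_dist_less_iff[OF N] product_complex_def)
next
  fix \<sigma> assume \<sigma>: "\<sigma> \<in> ?R"
  then have proj: "(\<lambda>x. x L) ` \<sigma> \<in> vietoris_rips ((\<lambda>x. x L) ` X) dist \<epsilon>"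
    if "L \<in> {1..N}" for L
    using that \<sigma> by (simp add: mem_vietoris_rips_iff max_dist_less_iff[OF N] image_mono)
  have "\<sigma> \<subseteq> extensional {1..N}"
    using \<sigma> by (auto simp: mem_vietoris_rips_iff X PiE_def)
  \<comment> \<open>Factor vertices must lie in some simplex; for \<open>x L\<close> with
    \<open>x\<close> in \<open>\<sigma>\<close>, the projection of \<open>\<sigma>\<close> is
    one.\<close>
  then have "\<sigma> \<subseteq> PiE {1..N} (\<lambda>L. \<Union>(vietoris_rips ((\<lambda>x. x L) ` X) dist \<epsilon>))"
    using proj unfolding PiE_iff subset_iff by (meson UnionI imageI)
  then show "\<sigma> \<in> ?P"
    using \<sigma> proj by (simp add: product_complex_def mem_vietoris_rips_iff)
qed

theorem corollary4p5p1:
  fixes f :: "real \<Rightarrow> real" and N n :: nat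
  assumes periodic: "\<And>t. f (t + 2 * pi) = f t"
    and N: "N \<ge> 1"
  shows "bcd_ray TYPE('k::field) n N (\<lambda>_. 1) (\<lambda>_. 0) (liouville_torus f N)
       = bcd_rips TYPE('k) n (liouville_torus f N) (max_dist N)"
proof -
  \<comment> \<open>The left side is left unsimplified to match the unfolded filtration;
    \<open>N \<ge> 1\<close> makes the divisor nonzero.\<close>
  have "0 + sqrt (real N) * t * 1 / L2_set (\<lambda>_. 1) {1..N} = t" for t
    using N by (simp add: L2_set_def)
  then have "ray_filtration N (\<lambda>_. 1) (\<lambda>_. 0) (liouville_torus f N)
      = vietoris_rips (liouville_torus f N) (max_dist N)"
    unfolding ray_filtration_def
    by (simp only: product_complex_vietoris_rips[OF N liouville_torus_def])
  then show ?thesis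
    by (simp add: bcd_ray_def bcd_rips_def)
qed

end
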